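(* Let $\mathcal{S}\in\mathbb{C}^{2n\times2n}$ be symplectic and let $R>1$, $\theta\in[0,2\pi)$ be such that $\sigma(\mathcal{S})\subseteq D_{R,\theta}$. Then $\mathrm{Log}(\mathcal{S})$ is Hamiltonian. Conversely, if $\mathcal{H}\in\mathbb{C}^{2n\times2n}$ is Hamiltonian, then $e^{\mathcal{H}}$ is symplectic.
   Context: $\mathcal{J}=\begin{bmatrix}0&I_n\\-I_n&0\end{bmatrix}$; $\mathcal{S}$ is symplectic if $\mathcal{S}\mathcal{J}\mathcal{S}^H=\mathcal{J}$, and $\mathcal{H}$ is Hamiltonian if $\mathcal{H}\mathcal{J}=(\mathcal{H}\mathcal{J})^H$. For $R>1$ and $\theta\in[0,2\pi)$, $D_{R,\theta}=\{z\in\mathbb{C}:1/R\le|z|\le R\}\setminus\{re^{i\theta}:1/R\le r\le R\}$ with boundary $\Gamma$ (positively oriented). For an invertible matrix $A$ with $\sigma(A)\subseteq D_{R,\theta}$, $\mathrm{Log}(A)=\frac{1}{2\pi i}\oint_\Gamma (zI-A)^{-1}\log z\,dz$, where $\log$ is the branch of the logarithm analytic on $\mathbb{C}$ minus the ray $\{re^{i\theta}:r\ge0\}$.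
   Formalization: The formal statement also assumes that no eigenvalue of S has modulus R or 1/R; otherwise the contour Γ passes through an eigenvalue and the integral defining Log(S) is undefined, e.g. S = diag(2, 1/2) with R = 2, θ = π. *)

theory Defs
  imports "HOL-Complex_Analysis.Complex_Analysis"
begin

text \<open>Matrices of size 2n x 2n are indexed by the finite type 'n + 'n
 (Inl = first block of n indices, Inr = second block).\<close>

definition Jmat :: "complex^('n::finite + 'n)^('n + 'n)" where
  "Jmat = (\<chi> i j. case (i, j) of
       (Inl a, Inr b) \<Rightarrow> (if a = b then 1 else 0)
     | (Inr a, Inl b) \<Rightarrow> (if a = b then -1 else 0)
     | _ \<Rightarrow> 0)"

definition conjT :: "complex^'m^'k \<Rightarrow> complex^'k^'m" where
  "conjT A = (\<chi> i j. cnj (A $ j $ i))"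

definition symplectic :: "complex^('n::finite + 'n)^('n + 'n) \<Rightarrow> bool" where
  "symplectic S \<longleftrightarrow> S ** Jmat ** conjT S = Jmat"

definition hamiltonian :: "complex^('n::finite + 'n)^('n + 'n) \<Rightarrow> bool" where
  "hamiltonian H \<longleftrightarrow> H ** Jmat = conjT (H ** Jmat)"

definition mspectrum :: "complex^'m::finite^'m \<Rightarrow> complex set" where
  "mspectrum A = {z. \<not> invertible (mat z - A)}"

fun mpow :: "complex^'m::finite^'m \<Rightarrow> nat \<Rightarrow> complex^'m^'m" where
  "mpow A 0 = mat 1"
| "mpow A (Suc k) = A ** mpow A k"

definition mexp :: "complex^'m::finite^'m \<Rightarrow> complex^'m^'m" where
  "mexp A = (\<Sum>k. (inverse (fact k)) *\<^sub>R mpow A k)"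

definition Dslit :: "real \<Rightarrow> real \<Rightarrow> complex set" where
  "Dslit R \<theta> = {z. 1/R \<le> cmod z \<and> cmod z \<le> R}
      - {complex_of_real r * cis \<theta> | r. 1/R \<le> r \<and> r \<le> R}"

text \<open>Branch of the logarithm analytic off the ray of angle theta, with
 imaginary part in (theta - 2 pi, theta] (value theta on the ray itself).\<close>
definition logb :: "real \<Rightarrow> complex \<Rightarrow> complex" where
  "logb \<theta> z = Ln (z * cis (pi - \<theta>)) + \<i> * complex_of_real (\<theta> - pi)"

text \<open>Log(A) = 1/(2 pi i) times the contour integral of (zI - A)^{-1} log z over the
 positively oriented boundary of D_{R,theta}: outer circle counterclockwise
 (arg from theta-2pi to theta), slit inward (boundary value of log: arg = theta),
 inner circle clockwise (arg from theta to theta-2pi), slit outward (boundary value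
 of log: arg = theta - 2pi). Computed entrywise.\<close>
definition mLog :: "real \<Rightarrow> real \<Rightarrow> complex^'m::finite^'m \<Rightarrow> complex^'m^'m" where
  "mLog R \<theta> A = (\<chi> i j.
     (1 / (2 * complex_of_real pi * \<i>)) *
       (contour_integral (part_circlepath 0 R (\<theta> - 2*pi) \<theta>)
           (\<lambda>z. matrix_inv (mat z - A) $ i $ j * logb \<theta> z)
      + contour_integral (linepath (complex_of_real R * cis \<theta>) (complex_of_real (1/R) * cis \<theta>))
           (\<lambda>z. matrix_inv (mat z - A) $ i $ j * logb \<theta> z)
      + contour_integral (part_circlepath 0 (1/R) \<theta> (\<theta> - 2*pi))
           (\<lambda>z. matrix_inv (mat z - A) $ i $ j * logb \<theta> z)
      + contour_integral (linepath (complex_of_real (1/R) * cis \<theta>) (complex_of_real R * cis \<theta>))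
           (\<lambda>z. matrix_inv (mat z - A) $ i $ j * (logb \<theta> z - 2 * complex_of_real pi * \<i>))))"

end

theory Submission
  imports Defs
begin

text \<open>Conjugation \<open>\<phi> X = J X\<^sup>H\<close> turns \<open>Q z = z (z - S)\<inverse>\<close> into \<open>\<phi> (Q z) = J - Q (1 / cnj z) J\<close> when \<open>S\<close>
  is symplectic, and the contour is symmetric under the reflection \<open>z \<mapsto> 1 / cnj z\<close>: it swaps the two
  circles (keeping the angle) and reverses the slit. Writing \<open>Log S\<close> as an integral of \<open>Q\<close> against
  \<open>dz / z\<close>, the constant terms cancel and \<open>\<phi> (Log S) = - Log S J\<close> remains. For the converse,
  \<open>exp (x H) J exp (x H)\<^sup>H\<close> has derivative \<open>0\<close> in \<open>x\<close> if \<open>H\<close> is Hamiltonian.\<close>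

no_notation fps_nth (infixl "$" 75)

section \<open>Algebra of matrix products, conjugate transposes and scalar matrices\<close>

lemma bounded_bilinear_matrix_matrix_mult:
  "bounded_bilinear ((**) :: complex^'m::finite^'k::finite \<Rightarrow> complex^'l::finite^'m \<Rightarrow> complex^'l^'k)"
proof -
  have "bilinear ((**) :: complex^'m::finite^'k::finite \<Rightarrow> complex^'l::finite^'m \<Rightarrow> complex^'l^'k)"
    unfolding bilinear_def
    by (auto intro!: linearI simp: matrix_matrix_mult_def vec_eq_iff
        sum.distrib scaleR_sum_right algebra_simps)
  then show ?thesis
    by (simp add: bilinear_conv_bounded_bilinear)
qed

interpretation mm: bounded_bilinear
  "(**) :: complex^'m::finite^'k::finite \<Rightarrow> complex^'l::finite^'m \<Rightarrow> complex^'l^'k"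
  by (rule bounded_bilinear_matrix_matrix_mult)

lemma bounded_linear_matrix_entry: "bounded_linear (\<lambda>A :: complex^'m::finite^'k::finite. A $ i $ j)"
  by (rule bounded_linear_compose[OF bounded_linear_vec_nth bounded_linear_vec_nth])

lemma bounded_linear_conjT: "bounded_linear (conjT :: complex^'m::finite^'k::finite \<Rightarrow> _)"
  unfolding linear_conv_bounded_linear[symmetric]
  by (rule linearI) (simp_all add: conjT_def vec_eq_iff)

lemma conjT_mult: "conjT (A ** B) = conjT B ** conjT A"
  by (simp add: conjT_def vec_eq_iff matrix_matrix_mult_def mult.commute)

lemma conjT_diff: "conjT (A - B) = conjT A - conjT B"
  by (simp add: conjT_def vec_eq_iff)

lemma conjT_mat: "conjT (mat c) = mat (cnj c)"
  by (simp add: conjT_def mat_def vec_eq_iff)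

lemma matrix_entry_mat_mult: "(mat c ** (A :: complex^'m^'k::finite)) $ i $ j = c * A $ i $ j"
  by (simp add: mat_def matrix_matrix_mult_def if_distrib[of "\<lambda>x. x * _"] cong: if_cong)

lemma matrix_entry_mult_mat: "((A :: complex^'m::finite^'k) ** mat c) $ i $ j = A $ i $ j * c"
  by (simp add: mat_def matrix_matrix_mult_def if_distrib[of "\<lambda>x. _ * x"] cong: if_cong)

lemma mat_mult_mat: "mat a ** mat b = (mat (a * b) :: complex^'m::finite^'m)"
  by (simp add: vec_eq_iff matrix_entry_mat_mult) (simp add: mat_def)

text \<open>Complex scalars are represented by \<open>mat c\<close>, while \<open>*\<^sub>R\<close>
  handles only real ones; this law lets them move through products.\<close>

lemma mat_mult_commute: "mat c ** (A :: complex^'m::finite^'k::finite) = A ** mat c"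
  by (simp add: vec_eq_iff matrix_entry_mat_mult matrix_entry_mult_mat)

lemma conjT_Jmat: "conjT Jmat = - Jmat"
  by (auto simp: vec_eq_iff conjT_def Jmat_def split: sum.splits)

text \<open>Since \<open>conjT Jmat = - Jmat\<close>, transposing \<open>H ** Jmat\<close> produces
  the minus sign. In this form the condition is a linear equation for the map \<open>X\<close> to
  \<open>Jmat ** conjT X\<close>, which can be pulled through integrals.\<close>

lemma hamiltonian_iff: "hamiltonian H \<longleftrightarrow> H ** Jmat = - (Jmat ** conjT H)"
  by (simp add: hamiltonian_def conjT_mult conjT_Jmat mm.minus_left)

section \<open>The matrix exponential and the converse direction\<close>

lemma mpow_scaleR: "mpow (x *\<^sub>R A) n = x ^ n *\<^sub>R mpow A n"
  by (induction n) (simp_all add: mm.scaleR_left mm.scaleR_right)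

lemma mpow_commute: "mpow A n ** A = A ** mpow A n"
  by (induction n) (simp_all add: matrix_mul_assoc[symmetric])

text \<open>The bound \<open>K\<close> of the bilinear product gives geometric growth of the powers,
  so a multiple of the real exponential series at \<open>norm A * K\<close> is a majorant.\<close>

lemma summable_norm_mexp:
  fixes A :: "complex^'m::finite^'m"
  shows "summable (\<lambda>n. norm (inverse (fact n) *\<^sub>R mpow A n))"
proof -
  obtain K where K: "K > 0" "\<And>(X :: complex^'m^'m) (Y :: complex^'m^'m). norm (X ** Y) \<le> norm X * norm Y * K"
    using mm.pos_bounded by blast
  have bound: "norm (mpow A n) \<le> norm (mat 1 :: complex^'m^'m) * (norm A * K) ^ n" for n
  proof (induction n)
    case (Suc n)
    have "norm (mpow A (Suc n)) \<le> norm A * norm (mpow A n) * K"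
      using K(2)[of A "mpow A n"] by simp
    also have "\<dots> \<le> norm A * (norm (mat 1 :: complex^'m^'m) * (norm A * K) ^ n) * K"
      using Suc K(1) by (intro mult_right_mono mult_left_mono) auto
    finally show ?case by (simp add: algebra_simps)
  qed simp
  show ?thesis
  proof (rule summable_comparison_test')
    show "summable (\<lambda>n. norm (mat 1 :: complex^'m^'m) * (inverse (fact n) * (norm A * K) ^ n))"
      by (intro summable_mult summable_exp)
    show "norm (norm (inverse (fact n) *\<^sub>R mpow A n))
        \<le> norm (mat 1 :: complex^'m^'m) * (inverse (fact n) * (norm A * K) ^ n)" if "n \<ge> 0" for n
      using mult_left_mono[OF bound[of n], of "inverse (fact n)"] by (simp add: algebra_simps)
  qed
qed

lemma mexp_sums: "(\<lambda>n. inverse (fact n) *\<^sub>R mpow A n) sums mexp A"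
  unfolding mexp_def by (rule summable_sums[OF summable_norm_cancel[OF summable_norm_mexp]])

lemma mexp_scaleR_commute:
  fixes A :: "complex^'m::finite^'m"
  shows "A ** mexp (x *\<^sub>R A) = mexp (x *\<^sub>R A) ** A"
proof (rule sums_unique2)
  have eq: "A ** (inverse (fact n) *\<^sub>R mpow (x *\<^sub>R A) n) = (inverse (fact n) *\<^sub>R mpow (x *\<^sub>R A) n) ** A" for n
    by (simp add: mpow_scaleR mm.scaleR_left mm.scaleR_right mpow_commute)
  show "(\<lambda>n. A ** (inverse (fact n) *\<^sub>R mpow (x *\<^sub>R A) n)) sums (A ** mexp (x *\<^sub>R A))"
    by (rule bounded_linear.sums[OF mm.bounded_linear_right mexp_sums])
  show "(\<lambda>n. A ** (inverse (fact n) *\<^sub>R mpow (x *\<^sub>R A) n)) sums (mexp (x *\<^sub>R A) ** A)"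
    unfolding eq by (rule bounded_linear.sums[OF mm.bounded_linear_left mexp_sums])
qed

lemma mexp_0 [simp]: "mexp (0 :: complex^'m::finite^'m) = mat 1"
proof (rule sums_unique2[OF mexp_sums])
  have "inverse (fact n) *\<^sub>R mpow (0 :: complex^'m^'m) n = (if n = 0 then mat 1 else 0)" for n
    by (cases n) simp_all
  then show "(\<lambda>n. inverse (fact n) *\<^sub>R mpow (0 :: complex^'m^'m) n) sums mat 1"
    using sums_If_finite_set[of "{0}" "\<lambda>n. mat 1 :: complex^'m^'m"] by simp
qed

text \<open>Each entry of \<open>mexp (x *\<^sub>R A)\<close> is a scalar power series in
  \<open>x\<close> that converges everywhere, so it may be differentiated term by term; the entries
  are then reassembled.\<close>

lemma has_vector_derivative_mexp:
  fixes A :: "complex^'m::finite^'m"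
  shows
  "((\<lambda>x. mexp (x *\<^sub>R A)) has_vector_derivative (A ** mexp (x *\<^sub>R A))) (at x within X)"
proof -
  have ent: "((\<lambda>x. mexp (x *\<^sub>R A) $ i $ j) has_vector_derivative ((A ** mexp (x *\<^sub>R A)) $ i $ j)) (at x within X)"
    for i j
  proof -
    define c where "c = (\<lambda>n. mpow A n $ i $ j / fact n)"
    have "summable (\<lambda>n. c n * y ^ n)" for y
    \<comment> \<open>An entry is bounded by the norm of its matrix, so the exponential series of
      \<open>norm y *\<^sub>R A\<close> dominates.\<close>
    proof (rule summable_norm_cancel, rule summable_comparison_test')
      show "summable (\<lambda>n. norm (inverse (fact n) *\<^sub>R mpow (norm y *\<^sub>R A) n))"
        by (rule summable_norm_mexp)
      show "norm (norm (c n * y ^ n)) \<le> norm (inverse (fact n) *\<^sub>R mpow (norm y *\<^sub>R A) n)" for n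
      proof -
        have "norm (mpow A n $ i $ j) \<le> norm (mpow A n)"
          using Finite_Cartesian_Product.norm_nth_le[of "mpow A n" i]
            Finite_Cartesian_Product.norm_nth_le[of "mpow A n $ i" j] by linarith
        then have "norm (mpow A n $ i $ j) * (norm y ^ n / fact n) \<le> norm (mpow A n) * (norm y ^ n / fact n)"
          by (rule mult_right_mono) simp
        then show ?thesis
          by (simp add: c_def mpow_scaleR norm_mult norm_divide norm_power field_simps)
      qed
    qed
    then have "((\<lambda>x. \<Sum>n. c n * x^n) has_field_derivative (\<Sum>n. diffs c n * (of_real x)^n)) (at (of_real x))"
      by (rule termdiffs_strong_converges_everywhere)
    also have "(\<Sum>n. diffs c n * (of_real x)^n) = (A ** mexp (x *\<^sub>R A)) $ i $ j"
    proof (rule sums_unique[symmetric])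
      have "(A ** (inverse (fact n) *\<^sub>R mpow (x *\<^sub>R A) n)) $ i $ j = diffs c n * (of_real x)^n" for n
      proof -
        have "(A ** (inverse (fact n) *\<^sub>R mpow (x *\<^sub>R A) n)) $ i $ j
            = (inverse (fact n) * x ^ n) *\<^sub>R mpow A (Suc n) $ i $ j"
          by (simp add: mpow_scaleR mm.scaleR_right)
        \<comment> \<open>\<open>diffs\<close> multiplies the coefficient of index n + 1 by n + 1,
          which reduces the factorial (n + 1)! to n!.\<close>
        also have "\<dots> = diffs c n * (of_real x)^n"
          unfolding diffs_def c_def scaleR_conv_of_real
          by (simp add: field_simps del: of_nat_Suc mpow.simps)
        finally show ?thesis .
      qed
      then show "(\<lambda>n. diffs c n * (of_real x)^n) sums (A ** mexp (x *\<^sub>R A)) $ i $ j"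
        using bounded_linear.sums[OF bounded_linear_matrix_entry[of i j]
            bounded_linear.sums[OF mm.bounded_linear_right[of A] mexp_sums[of "x *\<^sub>R A"]]]
        by simp
    qed
    finally have D: "((\<lambda>x. \<Sum>n. c n * (of_real x)^n) has_vector_derivative ((A ** mexp (x *\<^sub>R A)) $ i $ j)) (at x within X)"
      by (rule has_vector_derivative_at_within[OF has_vector_derivative_real_field])
    have "mexp (y *\<^sub>R A) $ i $ j = (\<Sum>n. c n * (of_real y)^n)" for y
    proof (rule sums_unique)
      have "(inverse (fact n) *\<^sub>R mpow (y *\<^sub>R A) n) $ i $ j = c n * (of_real y)^n" for n
        unfolding mpow_scaleR vector_scaleR_component unfolding c_def scaleR_conv_of_real
        by (simp add: field_simps)
      then show "(\<lambda>n. c n * (of_real y)^n) sums mexp (y *\<^sub>R A) $ i $ j"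
        using bounded_linear.sums[OF bounded_linear_matrix_entry[of i j] mexp_sums[of "y *\<^sub>R A"]] by simp
    qed
    then show ?thesis
      using D by simp
  qed
  show ?thesis
    \<comment> \<open>A basis matrix has one nonzero entry, a basis vector \<open>u\<close> of the
      complex plane; the inner product with it sees only that entry.\<close>
    unfolding has_vector_derivative_def has_derivative_componentwise_within[of "\<lambda>x. mexp (x *\<^sub>R A)"]
  proof
    fix b :: "complex^'m^'m" assume "b \<in> Basis"
    then obtain i j u where b: "b = axis i (axis j u)" "u \<in> Basis"
      by (auto simp: Basis_vec_def)
    show "((\<lambda>x. mexp (x *\<^sub>R A) \<bullet> b) has_derivative (\<lambda>h. (h *\<^sub>R (A ** mexp (x *\<^sub>R A))) \<bullet> b)) (at x within X)"
      using bounded_linear.has_vector_derivative[OF bounded_linear_inner_left[of u] ent[of i j]]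
      by (simp add: b inner_axis has_vector_derivative_def)
  qed
qed

lemma symplectic_mexp:
  assumes "hamiltonian H"
  shows "symplectic (mexp H)"
proof -
  define F where "F = (\<lambda>x. mexp (x *\<^sub>R H) ** Jmat ** conjT (mexp (x *\<^sub>R H)))"
  have "(F has_vector_derivative 0) (at x)" for x
  proof -
    let ?U = "mexp (x *\<^sub>R H)"
    have "(F has_vector_derivative
        (?U ** Jmat) ** conjT (H ** ?U) + (H ** ?U ** Jmat) ** conjT ?U) (at x)"
      unfolding F_def
      by (intro mm.has_vector_derivative has_vector_derivative_mexp
          bounded_linear.has_vector_derivative[OF mm.bounded_linear_left]
          bounded_linear.has_vector_derivative[OF bounded_linear_conjT])
    \<comment> \<open>Moving \<open>H\<close> inward puts both terms of the product rule between the
      same outer factors; what is left in the middle vanishes for Hamiltonian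
      \<open>H\<close>.\<close>
    also have "H ** ?U = ?U ** H"
      by (rule mexp_scaleR_commute)
    also have "(?U ** Jmat) ** conjT (?U ** H) + (?U ** H ** Jmat) ** conjT ?U
        = ?U ** (Jmat ** conjT H + H ** Jmat) ** conjT ?U"
      by (simp add: conjT_mult matrix_mul_assoc mm.add_right mm.add_left)
    finally show ?thesis
      using assms by (simp add: hamiltonian_iff mm.zero_left mm.zero_right)
  qed
  then have "F 1 = F 0"
    by (intro has_derivative_zero_unique[of UNIV]) (auto simp: has_vector_derivative_def)
  then show ?thesis
    by (simp add: F_def symplectic_def conjT_mat)
qed

section \<open>Inverses and continuity of the resolvent\<close>

lemma matrix_inv_right_left:
  assumes "invertible A"
  shows matrix_inv_right: "A ** matrix_inv A = mat 1"
    and matrix_inv_left: "matrix_inv A ** A = mat 1"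
  using someI_ex[OF assms[unfolded invertible_def]] unfolding matrix_inv_def by auto

lemma continuous_on_det:
  fixes F :: "'b::topological_space \<Rightarrow> complex^'m::finite^'m"
  assumes "\<And>i j. continuous_on X (\<lambda>x. F x $ i $ j)"
  shows "continuous_on X (\<lambda>x. det (F x))"
  unfolding det_def by (intro continuous_intros assms)

text \<open>Cramer's rule for the unit vector \<open>axis l 1\<close> on the right-hand side.
  Entries of the inverse become quotients of determinants, from which continuity can be read
  off.\<close>

lemma matrix_inv_entry:
  fixes A :: "complex^'m::finite^'m"
  assumes "invertible A"
  shows "matrix_inv A $ k $ l = det (\<chi> i j. if j = k then axis l 1 $ i else A $ i $ j) / det A"
proof -
  have "A *v (matrix_inv A *v axis l 1) = axis l 1"
    by (simp add: matrix_vector_mul_assoc matrix_inv_right assms)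
  then have "matrix_inv A *v axis l 1 = (\<chi> k. det (\<chi> i j. if j = k then axis l 1 $ i else A $ i $ j) / det A)"
    using cramer assms invertible_det_nz by blast
  then show ?thesis
    by (simp add: vec_eq_iff matrix_vector_mult_def axis_def if_distrib[of "\<lambda>x. _ * x"] cong: if_cong)
qed

lemma continuous_on_matrix_inv:
  fixes F :: "'b::topological_space \<Rightarrow> complex^'m::finite^'m"
  assumes "continuous_on X F" "\<And>x. x \<in> X \<Longrightarrow> invertible (F x)"
  shows "continuous_on X (\<lambda>x. matrix_inv (F x))"
proof -
  have ent: "continuous_on X (\<lambda>x. F x $ i $ j)" for i j
    by (intro continuous_intros assms)
  have "continuous_on X (\<lambda>x. \<chi> k l. det (\<chi> i j. if j = k then axis l 1 $ i else F x $ i $ j) / det (F x))"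
  proof (intro continuous_on_vec_lambda continuous_on_divide continuous_on_det)
    show "continuous_on X (\<lambda>x. (\<chi> i j. if j = k then axis l 1 $ i else F x $ i $ j) $ i $ j)" for k l i j
      using ent by (cases "j = k") simp_all
  qed (use assms(2) invertible_det_nz ent in auto)
  then show ?thesis
    by (rule continuous_on_eq) (simp add: vec_eq_iff matrix_inv_entry assms(2))
qed

text \<open>The factor z absorbs the line element: dz = \<i> z dt on a circle
  \<open>z = r * cis t\<close>, and dz = z ds on a ray \<open>z = exp s * c\<close>.\<close>

definition zres :: "complex^'m::finite^'m \<Rightarrow> complex \<Rightarrow> complex^'m^'m" where
  "zres A z = mat z ** matrix_inv (mat z - A)"

lemma continuous_on_mat: "continuous_on X (mat :: complex \<Rightarrow> complex^'m::finite^'m)"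
  unfolding mat_def
proof (intro continuous_on_vec_lambda)
  show "continuous_on X (\<lambda>c :: complex. if i = j then c else 0)" for i j :: 'm
    by (cases "i = j") (simp_all add: continuous_on_id)
qed

lemma continuous_on_resolvent:
  assumes "X \<inter> mspectrum A = {}"
  shows "continuous_on X (\<lambda>z. matrix_inv (mat z - A))"
proof (rule continuous_on_matrix_inv)
  show "continuous_on X (\<lambda>z. mat z - A)"
    by (intro continuous_on_diff continuous_on_const continuous_on_mat)
  show "invertible (mat z - A)" if "z \<in> X" for z
    using that assms by (auto simp: mspectrum_def)
qed

lemma continuous_on_zres:
  assumes "continuous_on X f" "\<And>x. x \<in> X \<Longrightarrow> f x \<notin> mspectrum A"
  shows "continuous_on X (\<lambda>x. zres A (f x))"
proof -
  have "continuous_on (f ` X) (zres A)"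
    unfolding zres_def
    by (intro mm.continuous_on continuous_on_mat continuous_on_resolvent) (use assms(2) in auto)
  then show ?thesis
    using assms(1) continuous_on_compose2 by blast
qed

text \<open>The point \<open>w\<close> is the reflection of \<open>z\<close> in the unit circle.
  Symplecticity gives S J (cnj z - S^H) = - (w - S) cnj z J, which relates the resolvent of S^H at
  cnj z to that of S at w.\<close>

lemma conjT_zres:
  fixes S :: "complex^('n::finite + 'n)^('n + 'n)"
  assumes S: "symplectic S" and z: "z \<notin> mspectrum S" and w: "w \<notin> mspectrum S"
    and wz: "w * cnj z = 1"
  shows "Jmat ** conjT (zres S z) = Jmat - zres S w ** Jmat"
proof -
  define C M where "C = conjT (matrix_inv (mat z - S))" and "M = (mat (cnj z) :: complex^('n + 'n)^('n + 'n))"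
  define Y where "Y = Jmat ** conjT (zres S z)"
  have inv: "matrix_inv (mat z - S) ** (mat z - S) = mat 1" "matrix_inv (mat w - S) ** (mat w - S) = mat 1"
    using z w by (simp_all add: mspectrum_def matrix_inv_left)
  have "(M - conjT S) ** C = mat 1"
    using arg_cong[OF inv(1), of conjT]
    by (simp add: conjT_mult conjT_diff conjT_mat C_def M_def)
  then have "S ** Jmat ** (M - conjT S) ** C = S ** Jmat"
    by (simp flip: matrix_mul_assoc)
  \<comment> \<open>The only use of symplecticity: \<open>S ** Jmat ** conjT S\<close> collapses to
    \<open>Jmat\<close>.\<close>
  moreover have "S ** Jmat ** (M - conjT S) = M ** S ** Jmat - Jmat"
    using S by (simp add: mm.diff_right symplectic_def M_def matrix_mul_assoc flip: mat_mult_commute)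
  ultimately have SJ: "(M ** S ** Jmat - Jmat) ** C = S ** Jmat"
    by simp
  have "conjT (zres S z) = M ** C"
    by (simp add: zres_def conjT_mult conjT_mat C_def M_def mat_mult_commute)
  then have Y: "Y = M ** Jmat ** C"
    by (simp add: Y_def M_def matrix_mul_assoc mat_mult_commute[of _ Jmat])
  have "mat w ** M = mat 1"
    using wz by (simp add: M_def mat_mult_mat)
  moreover have "S ** M = M ** S"
    by (simp add: M_def mat_mult_commute)
  ultimately have "(mat w - S) ** Y = (Jmat - M ** S ** Jmat) ** C"
    by (simp add: Y mm.diff_left matrix_mul_assoc)
  \<comment> \<open>The left side equals - S J by \<open>SJ\<close>. Adding and subtracting w J
    exposes a factor w - S, so that applying the resolvent at w leaves J minus a \<open>zres\<close>
    term.\<close>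
  also have "\<dots> = (mat w - S) ** Jmat - mat w ** Jmat"
    using SJ by (simp add: mm.diff_left algebra_simps)
  finally have "matrix_inv (mat w - S) ** ((mat w - S) ** Y)
      = matrix_inv (mat w - S) ** ((mat w - S) ** Jmat) - matrix_inv (mat w - S) ** (mat w ** Jmat)"
    by (simp only: mm.diff_right)
  then have "Y = Jmat - matrix_inv (mat w - S) ** mat w ** Jmat"
    by (simp add: matrix_mul_assoc inv)
  then show ?thesis
    by (simp only: Y_def zres_def mat_mult_commute[of w "matrix_inv (mat w - S)"])
qed

section \<open>The branch of the logarithm and the contour in real parameters\<close>

lemma logb_polar:
  assumes "r > 0" "\<theta> - 2 * pi < t" "t \<le> \<theta>"
  shows "logb \<theta> (of_real r * cis t) = of_real (ln r) + \<i> * of_real t"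
proof -
  have "of_real r * cis t * cis (pi - \<theta>) = exp (of_real (ln r) + \<i> * of_real (t + pi - \<theta>))"
    using assms(1)
    unfolding exp_add cis_conv_exp[symmetric] by (simp add: mult.assoc cis_mult exp_of_real add_diff_eq)
  \<comment> \<open>The rotation by \<pi> - \<theta> moves the angle into (-\<pi>, \<pi>], where the
    principal logarithm inverts \<open>exp\<close>.\<close>
  moreover have "Ln (exp (of_real (ln r) + \<i> * of_real (t + pi - \<theta>))) = of_real (ln r) + \<i> * of_real (t + pi - \<theta>)"
    using assms by (intro Ln_exp) auto
  ultimately show ?thesis
    by (simp add: logb_def algebra_simps)
qed

lemma contour_integral_resolvent_circle:
  assumes "r > 0"
  shows "contour_integral (part_circlepath 0 r (\<theta> - 2*pi) \<theta>)
          (\<lambda>z. matrix_inv (mat z - A) $ i $ j * logb \<theta> z)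
    = integral {\<theta> - 2*pi..\<theta>} (\<lambda>t. \<i> * (of_real (ln r) + \<i> * of_real t) * zres A (of_real r * cis t) $ i $ j)"
proof -
  have lt: "\<theta> - 2*pi < \<theta>" by simp
  show ?thesis
    unfolding contour_integral_part_circlepath_eq[OF lt]
    \<comment> \<open>At the left endpoint \<open>logb\<close> gives the angle \<theta> instead of
      \<theta> - 2 \<pi>; this one parameter value is negligible.\<close>
    by (rule integral_spike[of "{\<theta> - 2*pi}"])
       (use assms in \<open>auto simp: logb_polar zres_def matrix_entry_mat_mult\<close>)
qed

text \<open>Substituting z = exp(s) c makes the parameter interval symmetric about 0, so that
  inverting the radius becomes s to -s.\<close>

lemma contour_integral_linepath_ray:
  assumes "R > 1" and f: "continuous_on (closed_segment (of_real (1/R) * c) (of_real R * c)) f"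
  shows "contour_integral (linepath (of_real (1/R) * c) (of_real R * c)) f
    = integral {- ln R..ln R} (\<lambda>s. of_real (exp s) * c * f (of_real (exp s) * c))"
proof -
  let ?a = "of_real (1/R) * c" and ?b = "of_real R * c"
  define d where "d = R - 1/R"
  \<comment> \<open>\<open>g s\<close> is the affine parameter at which the segment passes through
    \<open>exp s * c\<close>.\<close>
  define g where "g = (\<lambda>s. (exp s - 1/R) / d)"
  define h where "h = (\<lambda>x. f (linepath ?a ?b x) * (?b - ?a))"
  have d: "d > 0" using assms(1) by (simp add: d_def field_simps) (smt (verit) mult_less_cancel_left1)
  have ends: "g (- ln R) = 0" "g (ln R) = 1"
    using assms(1) d by (auto simp: g_def d_def exp_minus field_simps)
  have lp: "linepath ?a ?b (g s) = of_real (exp s) * c" for s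
  proof -
    have "linepath ?a ?b (g s) = of_real (1/R + g s * d) * c"
      by (simp add: linepath_def d_def algebra_simps scaleR_conv_of_real diff_divide_distrib)
    then show ?thesis using d by (simp add: g_def)
  qed
  have "((\<lambda>s. (exp s / d) *\<^sub>R h (g s)) has_integral integral {g (- ln R)..g (ln R)} h) {- ln R..ln R}"
  proof (rule has_integral_substitution)
    have m: "g s \<le> g t" if "s \<le> t" for s t
      using that d by (simp add: g_def divide_right_mono)
    show "- ln R \<le> ln R" using assms(1) by simp
    then show "g (- ln R) \<le> g (ln R)" by (rule m)
    show "g ` {- ln R..ln R} \<subseteq> {0..1}"
      using m[of "- ln R"] m[of _ "ln R"] ends by auto
    show "continuous_on {0..1} h"
      unfolding h_def
      by (intro continuous_intros continuous_on_compose2[OF f])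
         (auto simp: linepath_in_path path_image_linepath[symmetric] path_image_def)
    show "(g has_field_derivative exp x / d) (at x within {- ln R..ln R})" for x
      unfolding g_def using d by (auto intro!: derivative_eq_intros)
  qed
  then have "integral {0..1} h = integral {- ln R..ln R} (\<lambda>s. (exp s / d) *\<^sub>R h (g s))"
    using ends by (simp add: integral_unique)
  also have "(\<lambda>s. (exp s / d) *\<^sub>R h (g s)) = (\<lambda>s. of_real (exp s) * c * f (of_real (exp s) * c))"
  proof
    fix s
    have "?b - ?a = of_real d * c" by (simp add: d_def algebra_simps)
    then show "(exp s / d) *\<^sub>R h (g s) = of_real (exp s) * c * f (of_real (exp s) * c)"
      unfolding h_def lp using d by (simp add: scaleR_conv_of_real field_simps)
  qed
  finally show ?thesis
    by (simp add: contour_integral_integral h_def)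
qed

lemma logb_ray:
  assumes "r > 0"
  shows "logb \<theta> (of_real r * cis \<theta>) = of_real (ln r) + \<i> * of_real \<theta>"
  using assms by (intro logb_polar) auto

lemma closed_segment_ray:
  fixes z c :: complex
  assumes "R > 1" "z \<in> closed_segment (of_real (1/R) * c) (of_real R * c)"
  obtains r where "1/R \<le> r" "r \<le> R" "z = of_real r * c"
proof -
  from assms(2) obtain u where u: "0 \<le> u" "u \<le> 1"
    "z = (1 - u) *\<^sub>R (of_real (1/R) * c) + u *\<^sub>R (of_real R * c)"
    by (auto simp: closed_segment_def)
  have R: "1 / R \<le> R" using assms(1) by (simp add: field_simps) (smt (verit) mult_less_cancel_left1)
  \<comment> \<open>The second instance of the convexity bound, with negated values, yields the
    lower bound.\<close>
  have "(1 - u) * (1/R) + u * R \<in> {1/R..R}"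
    using convex_bound_le[of "1/R" R R "1 - u" u] convex_bound_le[of "- (1/R)" "- (1/R)" "- R" "1 - u" u] u R by simp
  moreover have "z = of_real ((1 - u) * (1/R) + u * R) * c"
    using u(3) by (simp add: algebra_simps scaleR_conv_of_real)
  ultimately show ?thesis using that by auto
qed

text \<open>\<open>Dslit R \<theta>\<close> omits the slit but includes points of both circles;
  together with \<open>circles\<close>, the whole contour avoids the spectrum and the resolvent is
  continuous along it.\<close>

locale slit_annulus =
  fixes A :: "complex^'m::finite^'m" and R \<theta> :: real
  assumes R: "R > 1"
    and spectrum: "mspectrum A \<subseteq> Dslit R \<theta>"
    and circles: "\<And>z. z \<in> mspectrum A \<Longrightarrow> cmod z \<noteq> R \<and> cmod z \<noteq> 1/R"
begin

lemma not_spectrum_circle: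
  "of_real R * cis t \<notin> mspectrum A" "of_real (1/R) * cis t \<notin> mspectrum A"
  using circles[of "of_real R * cis t"] circles[of "of_real (1/R) * cis t"] R
  by (auto simp: norm_mult norm_divide)

lemma not_spectrum_ray:
  assumes "1/R \<le> r" "r \<le> R"
  shows "of_real r * cis \<theta> \<notin> mspectrum A"
  using spectrum assms unfolding Dslit_def by blast

lemma not_spectrum_ray_exp:
  assumes "s \<in> {- ln R..ln R}"
  shows "of_real (exp s) * cis \<theta> \<notin> mspectrum A"
proof (rule not_spectrum_ray)
  have "exp (- ln R) \<le> exp s" "exp s \<le> exp (ln R)"
    using assms by simp_all
  then show "1/R \<le> exp s" "exp s \<le> R"
    using R by (simp_all add: exp_minus inverse_eq_divide)
qed

text \<open>On the two sides of the slit the branches of the logarithm differ by \<open>2 \<pi> \<i>\<close>.\<close>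

lemma slit_integrals:
  "contour_integral (linepath (of_real R * cis \<theta>) (of_real (1/R) * cis \<theta>))
      (\<lambda>z. matrix_inv (mat z - A) $ i $ j * logb \<theta> z)
    + contour_integral (linepath (of_real (1/R) * cis \<theta>) (of_real R * cis \<theta>))
      (\<lambda>z. matrix_inv (mat z - A) $ i $ j * (logb \<theta> z - 2 * of_real pi * \<i>))
    = - (2 * of_real pi * \<i> * integral {- ln R..ln R} (\<lambda>s. zres A (of_real (exp s) * cis \<theta>) $ i $ j))"
proof -
  let ?p = "linepath (of_real (1/R) * cis \<theta>) (of_real R * cis \<theta>)"
  let ?seg = "closed_segment (of_real (1/R) * cis \<theta>) (of_real R * cis \<theta>)"
  let ?N = "\<lambda>z. matrix_inv (mat z - A) $ i $ j"
  have ray_pos: "\<exists>r>0. z = of_real r * cis \<theta>" if z: "z \<in> ?seg" for z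
  proof -
    obtain r where "1/R \<le> r" "z = of_real r * cis \<theta>"
      using closed_segment_ray[OF R z] by blast
    moreover from this R have "r > 0"
      by (smt (verit) zero_less_divide_1_iff)
    ultimately show ?thesis by blast
  qed
  have "?seg \<inter> mspectrum A = {}"
    using closed_segment_ray[OF R] not_spectrum_ray by blast
  then have N: "continuous_on ?seg ?N"
    by (intro continuous_on_component continuous_on_resolvent)
  \<comment> \<open>\<open>logb \<theta>\<close> jumps across the ray, but only continuity along the
    ray is required, and there its imaginary part is the constant \<theta>.\<close>
  have "continuous_on ?seg (\<lambda>z. of_real (ln (cmod z)) + \<i> * of_real \<theta>)"
    by (intro continuous_intros) (use ray_pos in fastforce)+
  then have "continuous_on ?seg (logb \<theta>)"
  proof (rule continuous_on_eq)
    fix z assume "z \<in> ?seg"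
    then obtain r where "r > 0" "z = of_real r * cis \<theta>"
      using ray_pos by blast
    then show "of_real (ln (cmod z)) + \<i> * of_real \<theta> = logb \<theta> z"
      by (simp add: logb_ray norm_mult)
  qed
  with N have int: "(\<lambda>z. ?N z * logb \<theta> z) contour_integrable_on ?p"
    "(\<lambda>z. ?N z * (2 * of_real pi * \<i>)) contour_integrable_on ?p"
    by (auto intro!: contour_integrable_continuous_linepath continuous_intros)
  \<comment> \<open>The inward run is the outward run reversed, so the \<open>logb\<close> terms
    cancel and only the constant jump of the branch survives.\<close>
  have "contour_integral (reversepath ?p) (\<lambda>z. ?N z * logb \<theta> z)
      = - contour_integral ?p (\<lambda>z. ?N z * logb \<theta> z)"
    by (rule contour_integral_reversepath) simp
  moreover have "contour_integral ?p (\<lambda>z. ?N z * (logb \<theta> z - 2 * of_real pi * \<i>))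
      = contour_integral ?p (\<lambda>z. ?N z * logb \<theta> z) - contour_integral ?p (\<lambda>z. ?N z * (2 * of_real pi * \<i>))"
    using contour_integral_diff[OF int] by (simp add: algebra_simps)
  moreover have "contour_integral ?p (\<lambda>z. ?N z * (2 * of_real pi * \<i>))
      = integral {- ln R..ln R} (\<lambda>s. 2 * of_real pi * \<i> * (zres A (of_real (exp s) * cis \<theta>) $ i $ j))"
    using R N by (subst contour_integral_linepath_ray)
      (auto intro!: continuous_intros simp: zres_def matrix_entry_mat_mult mult_ac)
  ultimately show ?thesis
    by simp
qed

definition outer_circle :: "real \<Rightarrow> complex^'m^'m" where
  "outer_circle t = zres A (of_real R * cis t)"

definition inner_circle :: "real \<Rightarrow> complex^'m^'m" where
  "inner_circle t = zres A (of_real (1/R) * cis t)"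

definition slit :: "real \<Rightarrow> complex^'m^'m" where
  "slit s = zres A (of_real (exp s) * cis \<theta>)"

text \<open>Both circles in one integrand. The inner circle is run clockwise and has log-modulus -
  ln R, so its modulus term adds to the outer one while its angle term is subtracted. The prefactor
  is what remains of 1 / (2 \<pi> \<i>) after the \<i> from dz = \<i> z dt is cancelled.\<close>

definition density :: "real \<Rightarrow> complex^'m^'m" where
  "density t = (1 / (2*pi)) *\<^sub>R (ln R *\<^sub>R (outer_circle t + inner_circle t) + t *\<^sub>R (mat \<i> ** (outer_circle t - inner_circle t)))"

lemma continuous_on_zres_paths:
  "continuous_on X outer_circle" "continuous_on X inner_circle" "continuous_on {- ln R..ln R} slit"
  unfolding outer_circle_def inner_circle_def slit_def
  by (intro continuous_on_zres continuous_intros not_spectrum_circle not_spectrum_ray_exp; assumption)+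

lemma integrable_density: "density integrable_on {a..b}"
  unfolding density_def
  by (intro integrable_continuous_real continuous_intros mm.continuous_on continuous_on_zres_paths)

lemma integrable_slit: "slit integrable_on {- ln R..ln R}"
  by (intro integrable_continuous_real continuous_on_zres_paths)

text \<open>The two circles combine into \<open>density\<close>. On the slit the jump 2 \<pi> \<i>
  cancels the normalisation of the contour integral, leaving the plain integral of
  \<open>slit\<close> with a minus sign.\<close>

lemma mLog_eq: "mLog R \<theta> A = integral {\<theta> - 2*pi..\<theta>} density - integral {- ln R..ln R} slit"
proof -
  have "mLog R \<theta> A $ i $ j = (integral {\<theta> - 2*pi..\<theta>} density - integral {- ln R..ln R} slit) $ i $ j" for i j
  proof -
    let ?I = "integral {\<theta> - 2*pi..\<theta>}"
    let ?out = "\<lambda>t. \<i> * (of_real (ln R) + \<i> * of_real t) * outer_circle t $ i $ j"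
    let ?inn = "\<lambda>t. \<i> * (of_real (ln (1/R)) + \<i> * of_real t) * inner_circle t $ i $ j"
    let ?N = "\<lambda>z. matrix_inv (mat z - A) $ i $ j * logb \<theta> z"
    have out: "contour_integral (part_circlepath 0 R (\<theta> - 2*pi) \<theta>) ?N = ?I ?out"
      using contour_integral_resolvent_circle[of R] R by (simp add: outer_circle_def)
    have "contour_integral (reversepath (part_circlepath 0 (1/R) (\<theta> - 2*pi) \<theta>)) ?N
        = - contour_integral (part_circlepath 0 (1/R) (\<theta> - 2*pi) \<theta>) ?N"
      by (rule contour_integral_reversepath) simp
    then have inn: "contour_integral (part_circlepath 0 (1/R) \<theta> (\<theta> - 2*pi)) ?N = - ?I ?inn"
      using contour_integral_resolvent_circle[of "1/R"] R by (simp add: inner_circle_def)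
    have int: "?out integrable_on {\<theta> - 2*pi..\<theta>}" "?inn integrable_on {\<theta> - 2*pi..\<theta>}"
      by (auto intro!: integrable_continuous_real continuous_intros continuous_on_zres_paths)
    have "?I ?out - ?I ?inn = ?I (\<lambda>t. ?out t - ?inn t)"
      using int by (rule integral_diff[symmetric])
    also have "(\<lambda>t. ?out t - ?inn t) = (\<lambda>t. 2 * of_real pi * \<i> * density t $ i $ j)"
      using R
      unfolding density_def vector_scaleR_component vector_add_component vector_minus_component matrix_entry_mat_mult
      unfolding scaleR_conv_of_real
      by (intro ext) (simp add: ln_div field_simps)
    also have "?I \<dots> = 2 * of_real pi * \<i> * ?I density $ i $ j"
      using integral_linear[OF integrable_density bounded_linear_matrix_entry, unfolded o_def]
      by simp
    finally have circ: "?I ?out - ?I ?inn = 2 * of_real pi * \<i> * ?I density $ i $ j" .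
    have sl: "integral {- ln R..ln R} (\<lambda>s. zres A (of_real (exp s) * cis \<theta>) $ i $ j)
        = integral {- ln R..ln R} slit $ i $ j"
      using integral_linear[OF integrable_slit bounded_linear_matrix_entry, unfolded o_def]
      by (simp add: slit_def)
    have "mLog R \<theta> A $ i $ j = 1 / (2 * of_real pi * \<i>) * ((?I ?out + - ?I ?inn) +
        - (2 * of_real pi * \<i> * integral {- ln R..ln R} slit $ i $ j))"
      unfolding out[symmetric] inn[symmetric] slit_integrals[of i j, unfolded sl, symmetric] mLog_def
      by (simp only: vec_lambda_beta add_ac)
    also have "?I ?out + - ?I ?inn = 2 * of_real pi * \<i> * ?I density $ i $ j"
      using circ by (simp only: diff_conv_add_uminus)
    finally show ?thesis
      by (simp add: diff_divide_distrib)
  qed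
  then show ?thesis
    by (simp add: vec_eq_iff)
qed

end

section \<open>The reflection symmetry applied to the logarithm\<close>

lemma hamiltonian_mLog:
  fixes S :: "complex^('n::finite + 'n)^('n + 'n)"
  assumes S: "symplectic S" and R: "R > 1" and spec: "mspectrum S \<subseteq> Dslit R \<theta>"
    and circ: "\<And>z. z \<in> mspectrum S \<Longrightarrow> cmod z \<noteq> R \<and> cmod z \<noteq> 1/R"
  shows "hamiltonian (mLog R \<theta> S)"
proof -
  interpret slit_annulus S R \<theta>
    using R spec circ by unfold_locales
  let ?\<phi> = "\<lambda>X. Jmat ** conjT X"
  have phi: "bounded_linear ?\<phi>"
    by (rule bounded_linear_compose[OF mm.bounded_linear_right bounded_linear_conjT])
  interpret phi: bounded_linear ?\<phi> by (rule phi)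
  let ?J = "Jmat :: complex^('n + 'n)^('n + 'n)"
  let ?D = "integral {\<theta> - 2*pi..\<theta>} density" and ?K = "integral {- ln R..ln R} slit"
  \<comment> \<open>Points at equal angle with reciprocal moduli are reflections of each other, as
    \<open>conjT_zres\<close> requires.\<close>
  have recip: "of_real a * cis t * cnj (of_real b * cis t) = 1" if "a * b = 1" for a b t
  proof -
    have "of_real a * cis t * cnj (of_real b * cis t) = of_real (a * b) * (cis t * cis (- t))"
      by (simp add: cis_cnj mult_ac)
    then show ?thesis
      by (simp add: that cis_mult)
  qed
  have phi_outer: "?\<phi> (outer_circle t) = ?J - inner_circle t ** ?J" for t
    unfolding outer_circle_def inner_circle_def
    using R by (intro conjT_zres[OF S] not_spectrum_circle recip) simp
  have phi_inner: "?\<phi> (inner_circle t) = ?J - outer_circle t ** ?J" for t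
    unfolding outer_circle_def inner_circle_def
    using R by (intro conjT_zres[OF S] not_spectrum_circle recip) simp
  have phi_slit: "?\<phi> (slit s) = ?J - slit (- s) ** ?J" if "s \<in> {- ln R..ln R}" for s
    unfolding slit_def
  proof (rule conjT_zres[OF S])
    show "complex_of_real (exp (- s)) * cis \<theta> * cnj (complex_of_real (exp s) * cis \<theta>) = 1"
      by (rule recip) (simp add: exp_minus)
  qed (use that not_spectrum_ray_exp[of s] not_spectrum_ray_exp[of "- s"] in auto)
  \<comment> \<open>The map is conjugate-linear. This sign offsets the one that the difference of
    the two circles acquires when the reflection swaps them.\<close>
  have phi_i: "?\<phi> (mat \<i> ** X) = - (mat \<i> ** ?\<phi> X)" for X :: "complex^('n + 'n)^('n + 'n)"
  proof -
    have m: "mat (- \<i>) = - (mat \<i> :: complex^('n + 'n)^('n + 'n))"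
      by (simp add: mat_def vec_eq_iff)
    show ?thesis
      by (simp add: conjT_mult conjT_mat m mm.minus_left mm.minus_right matrix_mul_assoc flip: mat_mult_commute)
  qed
  \<comment> \<open>Only the sum of the circle terms contributes constants, namely 2 J weighted by
    ln R / (2 \<pi>); in the difference they cancel.\<close>
  have phi_density: "?\<phi> (density t) = (ln R / pi) *\<^sub>R ?J - density t ** ?J" for t
  proof -
    have half: "(ln R / pi) *\<^sub>R ?J = (1 / (2*pi)) *\<^sub>R ln R *\<^sub>R (?J + ?J)"
      unfolding scaleR_2[symmetric] by simp
    show ?thesis
      unfolding half density_def phi.scaleR phi.add phi_i phi.diff phi_outer phi_inner
      by (simp add: mm.add_left mm.diff_left mm.scaleR_left mm.diff_right matrix_mul_assoc algebra_simps flip: scaleR_add_left)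
  qed
  have "?\<phi> ?D = integral {\<theta> - 2*pi..\<theta>} (\<lambda>t. ?\<phi> (density t))"
    using integral_linear[OF integrable_density phi] by (simp add: o_def)
  also have "\<dots> = integral {\<theta> - 2*pi..\<theta>} (\<lambda>t. (ln R / pi) *\<^sub>R ?J) - integral {\<theta> - 2*pi..\<theta>} (\<lambda>t. density t ** ?J)"
    unfolding phi_density
    by (intro integral_diff integrable_const_ivl)
       (rule integrable_linear[OF integrable_density mm.bounded_linear_left, unfolded o_def])
  also have "\<dots> = (2 * ln R) *\<^sub>R ?J - ?D ** ?J"
    using integral_linear[OF integrable_density[of "\<theta> - 2*pi" \<theta>] mm.bounded_linear_left[of ?J]]
    by (simp add: o_def mult.commute)
  finally have D: "?\<phi> ?D = (2 * ln R) *\<^sub>R ?J - ?D ** ?J" .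
  \<comment> \<open>Reflection reverses the slit, but its logarithmic parameter interval is
    symmetric, so the integral is unchanged.\<close>
  have refl: "integral {- ln R..ln R} (\<lambda>s. slit (- s)) = ?K"
    using Henstock_Kurzweil_Integration.integral_reflect_real[where a = "- ln R" and b = "ln R" and f = slit] by simp
  have refl_int: "(\<lambda>s. slit (- s)) integrable_on {- ln R..ln R}"
    using integrable_slit Henstock_Kurzweil_Integration.integrable_reflect_real[where a = "- ln R" and b = "ln R" and f = slit] by simp
  have "?\<phi> ?K = integral {- ln R..ln R} (\<lambda>s. ?\<phi> (slit s))"
    using integral_linear[OF integrable_slit phi] by (simp add: o_def)
  also have "\<dots> = integral {- ln R..ln R} (\<lambda>s. ?J - slit (- s) ** ?J)"
    by (intro integral_cong phi_slit)
  also have "\<dots> = integral {- ln R..ln R} (\<lambda>s. ?J) - integral {- ln R..ln R} (\<lambda>s. slit (- s) ** ?J)"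
    by (intro integral_diff integrable_const_ivl)
       (rule integrable_linear[OF refl_int mm.bounded_linear_left, unfolded o_def])
  also have "\<dots> = (2 * ln R) *\<^sub>R ?J - ?K ** ?J"
    using integral_linear[OF refl_int mm.bounded_linear_left[of ?J]] R by (simp add: o_def refl)
  finally have K: "?\<phi> ?K = (2 * ln R) *\<^sub>R ?J - ?K ** ?J" .
  \<comment> \<open>The circles contribute 2 \<pi> times ln R / \<pi>, the slit the length 2 ln R of
    its parameter interval. These equal multiples of J cancel in the difference.\<close>
  show ?thesis
    unfolding hamiltonian_iff mLog_eq phi.diff D K by (simp add: mm.diff_left)
qed

theorem theoremA1:
  fixes S H :: "complex^('n::finite + 'n)^('n + 'n)" and R \<theta> :: real
  shows "(symplectic S \<and> R > 1 \<and> 0 \<le> \<theta> \<and> \<theta> < 2 * pi \<and> mspectrum S \<subseteq> Dslit R \<theta>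
            \<and> (\<forall>z\<in>mspectrum S. cmod z \<noteq> R \<and> cmod z \<noteq> 1/R)
          \<longrightarrow> hamiltonian (mLog R \<theta> S))
       \<and> (hamiltonian H \<longrightarrow> symplectic (mexp H))"
  using hamiltonian_mLog symplectic_mexp by blast

end
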